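(* Let $n\ge 1$ be an integer, let $1<p<\infty$ with $1/p+1/p'=1$, and let $\lambda,\alpha,\beta$ be real numbers with $0<\lambda<n$, $\alpha<n/p$, $\beta<n/p'$ and $n=\lambda+\alpha+\beta$. Then for every $f\in L^p(\mathbb{R}^n)$, $$\Big\|\,|x|^{-\alpha}\Big(|x|^{-\lambda}*\big(|x|^{-\beta}f\big)\Big)\Big\|_{L^p(\mathbb{R}^n)}\le D_{\alpha,\beta}\,\|f\|_{L^p(\mathbb{R}^n)},$$ where $$D_{\alpha,\beta}=\pi^{n/2}\left[\frac{\Gamma\big(\frac{\alpha+\beta}{2}\big)\,\Gamma\big(\frac{n}{2p}-\frac{\alpha}{2}\big)\,\Gamma\big(\frac{n}{2p'}-\frac{\beta}{2}\big)}{\Gamma\big(\frac{n-\alpha-\beta}{2}\big)\,\Gamma\big(\frac{n}{2p'}+\frac{\alpha}{2}\big)\,\Gamma\big(\frac{n}{2p}+\frac{\beta}{2}\big)}\right].$$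
   Context: $*$ denotes convolution on $\mathbb{R}^n$, so that $\big(|x|^{-\lambda}*F\big)(x)=\int_{\mathbb{R}^n}|x-y|^{-\lambda}F(y)\,dy$. $\Gamma$ is the Euler Gamma function. *)

theory Defs
  imports "HOL-Analysis.Analysis"
begin

text \<open>
  \<open>L\<^sup>p\<close> spaces of complex-valued functions on Euclidean space, for the (complete) Lebesgue
  measure and a finite exponent. Functions are not identified modulo null sets.
  Since the Bochner integral of a non-integrable function is \<open>0\<close>, \<open>Lp_norm p f\<close> is meaningful
  only together with \<open>in_Lp p f\<close>.
\<close>

definition in_Lp :: "real \<Rightarrow> ('a::euclidean_space \<Rightarrow> complex) \<Rightarrow> bool" where
  "in_Lp p f \<longleftrightarrow>
     f \<in> borel_measurable lebesgue \<and> integrable lebesgue (\<lambda>x. norm (f x) powr p)"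

definition Lp_norm :: "real \<Rightarrow> ('a::euclidean_space \<Rightarrow> complex) \<Rightarrow> real" where
  "Lp_norm p f = (LINT x|lebesgue. norm (f x) powr p) powr (1 / p)"

text \<open>
  Convolution of a real kernel with a complex function. At points where the integral does not
  converge absolutely, \<open>convolution k F x\<close> takes the junk value \<open>0\<close>, so convergence is a separate
  predicate.
\<close>

definition convolution_converges ::
    "('a::euclidean_space \<Rightarrow> real) \<Rightarrow> ('a \<Rightarrow> complex) \<Rightarrow> 'a \<Rightarrow> bool" where
  "convolution_converges k F x \<longleftrightarrow> integrable lebesgue (\<lambda>y. k (x - y) *\<^sub>R F y)"

definition convolution ::
    "('a::euclidean_space \<Rightarrow> real) \<Rightarrow> ('a \<Rightarrow> complex) \<Rightarrow> 'a \<Rightarrow> complex" where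
  "convolution k F x = (LINT y|lebesgue. k (x - y) *\<^sub>R F y)"

text \<open>
  The weight \<open>|x|\<^sup>a\<close>. At the origin \<open>powr\<close> gives \<open>0\<close> for every exponent, which only affects a
  null set.
\<close>

definition norm_power :: "real \<Rightarrow> 'a::euclidean_space \<Rightarrow> real" where
  "norm_power a x = norm x powr a"

definition stein_weiss_const :: "nat \<Rightarrow> real \<Rightarrow> real \<Rightarrow> real \<Rightarrow> real \<Rightarrow> real" where
  "stein_weiss_const n p p' \<alpha> \<beta> =
     pi powr (real n / 2) *
     ((Gamma ((\<alpha> + \<beta>) / 2) * Gamma (real n / (2 * p) - \<alpha> / 2) *
       Gamma (real n / (2 * p') - \<beta> / 2)) /
      (Gamma ((real n - \<alpha> - \<beta>) / 2) * Gamma (real n / (2 * p') + \<alpha> / 2) *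
       Gamma (real n / (2 * p) + \<beta> / 2)))"

end

theory Submission
  imports "HOL-Probability.Distributions" Defs
begin

text \<open>
  The operator \<open>f \<mapsto> |x|\<^sup>-\<^sup>\<alpha> (|x|\<^sup>-\<^sup>\<lambda> * (|x|\<^sup>-\<^sup>\<beta> f))\<close> has the positive kernel
  \<open>K(x,y) = |x|\<^sup>-\<^sup>\<alpha> |x-y|\<^sup>-\<^sup>\<lambda> |y|\<^sup>-\<^sup>\<beta>\<close>, which is rotation invariant and, because \<open>\<lambda> + \<alpha> + \<beta> = n\<close>,
  homogeneous of degree \<open>-n\<close>. Such an operator maps powers of \<open>|x|\<close> to multiples of themselves where
  the integrals converge, and the power \<open>|x|\<close> to the exponent \<open>-n/p\<close>, which just fails to be in
  \<open>L\<^sup>p\<close>, is the extremal candidate. Its eigenvalue \<open>D\<close> is the constant \<open>stein_weiss_const\<close>, and the same number is the eigenvalue of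
  the transposed kernel at \<open>|x|\<close> to the exponent \<open>-n/p'\<close>. The Schur test (\<open>Schur_test\<close>) with the
  weight \<open>h(x) = |x|\<close> to the exponent \<open>-n/(pp')\<close>, for which \<open>h powr p'\<close> and \<open>h powr p\<close> are exactly
  these two powers, therefore bounds the norm by \<open>D\<close> without any loss.

  What remains is to compute the eigenvalue, that is, the convolution of two powers of \<open>|x|\<close>
  (\<open>nn_integral_Riesz_composition\<close>). Each power is written as a superposition of Gaussians,
  \<open>\<Gamma>(a) |x| powr (-2a) = \<integral> s powr (a-1) * exp(-s|x|\<^sup>2) ds\<close>, two Gaussians are convolved by completing
  the square, and the two parameters are integrated out: with \<open>t = s r\<close> the integral in \<open>s\<close> is a Gamma
  integral again and the one in \<open>r\<close> is a Beta integral.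

  All this takes place with nonnegative integrals of Borel functions, where Tonelli's theorem is
  unconditional. For a complex \<open>f\<close> the bound for \<open>|f|\<close> yields absolute convergence almost everywhere,
  and with it the estimate.
\<close>

section \<open>Gamma, Beta and Gaussian integrals\<close>

text \<open>
  The density of the measure \<open>t powr (z - 1) dt\<close> on the positive half-line. The cut-off is explicit
  because \<open>powr\<close> does not vanish at a negative base.
\<close>

definition half_line_power :: "real \<Rightarrow> real \<Rightarrow> real" where
  "half_line_power z t = (if 0 < t then t powr (z - 1) else 0)"

lemma half_line_power_measurable [measurable]: "half_line_power z \<in> borel_measurable borel"
  unfolding half_line_power_def [abs_def] by measurable

lemma half_line_power_nonneg [simp]: "0 \<le> half_line_power z t"
  by (simp add: half_line_power_def)

lemma half_line_power_scale:
  "0 < c \<Longrightarrow> half_line_power z (c * t) = c powr (z - 1) * half_line_power z t"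
  by (simp add: half_line_power_def powr_mult zero_less_mult_iff)

lemma nn_integral_lborel_scale:
  fixes c :: real
  assumes [measurable]: "f \<in> borel_measurable borel" and c: "0 < c"
  shows "(\<integral>\<^sup>+t. f t \<partial>lborel) = ennreal c * (\<integral>\<^sup>+t. f (c * t) \<partial>lborel)"
  using nn_integral_real_affine [of f c 0] c by simp

text \<open>
  For \<open>c = |x|\<^sup>2\<close> this is the subordination formula: it represents the power \<open>|x| powr (-2z)\<close> as a
  superposition of Gaussians.
\<close>

lemma nn_integral_Gamma_scaled:
  assumes z: "0 < z" and c: "0 < c"
  shows "(\<integral>\<^sup>+t. ennreal (half_line_power z t * exp (- (c * t))) \<partial>lborel) =
         ennreal (Gamma z * c powr - z)"
proof -
  have "ennreal (Gamma z) =
        (\<integral>\<^sup>+t. ennreal (half_line_power z t * exp (- t)) \<partial>lborel)"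
    unfolding Gamma_conv_nn_integral_real [OF z]
    by (intro nn_integral_cong_AE AE_I [where N = "{0}"])
       (auto simp: half_line_power_def exp_minus field_simps split: split_indicator)
  also have "\<dots> = ennreal c * (\<integral>\<^sup>+t. ennreal (half_line_power z (c * t) * exp (- (c * t))) \<partial>lborel)"
    by (rule nn_integral_lborel_scale [OF _ c]) measurable
  also have "\<dots> = ennreal c * (\<integral>\<^sup>+t. ennreal (c powr (z - 1)) *
                    ennreal (half_line_power z t * exp (- (c * t))) \<partial>lborel)"
    using c by (simp add: half_line_power_scale ennreal_mult' [symmetric] mult.assoc)
  also have "\<dots> = ennreal (c powr z) * (\<integral>\<^sup>+t. ennreal (half_line_power z t * exp (- (c * t))) \<partial>lborel)"
    using c by (subst nn_integral_cmult)
      (auto simp: mult.assoc [symmetric] ennreal_mult' [symmetric] powr_diff)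
  finally have "ennreal (c powr - z) * ennreal (Gamma z) =
      ennreal (c powr - z) * (ennreal (c powr z) *
         (\<integral>\<^sup>+t. ennreal (half_line_power z t * exp (- (c * t))) \<partial>lborel))"
    by simp
  also have "\<dots> = (\<integral>\<^sup>+t. ennreal (half_line_power z t * exp (- (c * t))) \<partial>lborel)"
    using c by (simp add: mult.assoc [symmetric] ennreal_mult' [symmetric] powr_add [symmetric])
  finally show ?thesis
    using z by (simp add: ennreal_mult' [symmetric] mult.commute)
qed

lemma nn_integral_gaussian_real:
  assumes c: "0 < c"
  shows "(\<integral>\<^sup>+t. ennreal (exp (- (c * t\<^sup>2))) \<partial>lborel) = ennreal (sqrt (pi / c))"
proof -
  let ?\<sigma> = "1 / sqrt (2 * c)"
  have \<sigma>: "0 < ?\<sigma>" using c by simp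
  have eq: "exp (- (c * t\<^sup>2)) = sqrt (pi / c) * normal_density 0 ?\<sigma> t" for t
    using c by (simp add: normal_density_def power_divide real_sqrt_divide field_simps)
  have "(\<integral>\<^sup>+t. ennreal (exp (- (c * t\<^sup>2))) \<partial>lborel) =
        ennreal (sqrt (pi / c)) * (\<integral>\<^sup>+t. ennreal (normal_density 0 ?\<sigma> t) \<partial>lborel)"
    unfolding eq using c by (subst nn_integral_cmult [symmetric]) (auto simp: ennreal_mult')
  also have "(\<integral>\<^sup>+t. ennreal (normal_density 0 ?\<sigma> t) \<partial>lborel) = 1"
    using integrable_normal_density [OF \<sigma>, of 0] integral_normal_density [OF \<sigma>, of 0]
    by (subst nn_integral_eq_integral) auto
  finally show ?thesis by simp
qed

lemma nn_integral_gaussian: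
  assumes c: "0 < c"
  shows "(\<integral>\<^sup>+y. ennreal (exp (- (c * (norm (y::'a::euclidean_space))\<^sup>2))) \<partial>lborel) =
         ennreal ((pi / c) powr (DIM('a) / 2))"
proof -
  have "(\<integral>\<^sup>+y. ennreal (exp (- (c * (norm (y::'a))\<^sup>2))) \<partial>lborel) =
        (\<integral>\<^sup>+y. (\<Prod>b\<in>Basis. ennreal (exp (- (c * (y \<bullet> (b::'a))\<^sup>2)))) \<partial>lborel)"
  proof (rule nn_integral_cong)
    fix y :: 'a
    have "(norm y)\<^sup>2 = (\<Sum>b\<in>Basis. (y \<bullet> b)\<^sup>2)"
      unfolding power2_norm_eq_inner by (subst euclidean_inner) (simp add: power2_eq_square)
    then show "ennreal (exp (- (c * (norm y)\<^sup>2))) = (\<Prod>b\<in>Basis. ennreal (exp (- (c * (y \<bullet> b)\<^sup>2))))"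
      by (simp add: prod_ennreal exp_sum [symmetric] sum_distrib_left sum_negf)
  qed
  also have "\<dots> = (\<Prod>b\<in>(Basis::'a set). (\<integral>\<^sup>+t. ennreal (exp (- (c * t\<^sup>2))) \<partial>lborel))"
    by (rule nn_integral_lborel_prod) auto
  also have "\<dots> = ennreal (sqrt (pi / c) ^ DIM('a))"
    using c by (simp add: nn_integral_gaussian_real ennreal_power)
  also have "sqrt (pi / c) ^ DIM('a) = (pi / c) powr (DIM('a) / 2)"
    using c by (simp add: powr_half_sqrt [symmetric] powr_realpow [symmetric] powr_powr)
  finally show ?thesis .
qed

text \<open>
  Completing the square: the exponent is minimal at \<open>y = s/(s+t) x\<close>, with minimum
  \<open>st/(s+t) |x|\<^sup>2\<close>, and after translation by that point a centred Gaussian with parameter \<open>s + t\<close>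
  remains.
\<close>

lemma nn_integral_gaussian_product:
  fixes x :: "'a::euclidean_space"
  assumes s: "0 < s" and t: "0 < t"
  shows "(\<integral>\<^sup>+y. ennreal (exp (- (s * (norm (x - y))\<^sup>2)) * exp (- (t * (norm y)\<^sup>2))) \<partial>lborel) =
         ennreal ((pi / (s + t)) powr (DIM('a) / 2) * exp (- (s * t / (s + t) * (norm x)\<^sup>2)))"
proof -
  let ?m = "(s / (s + t)) *\<^sub>R x"
  let ?E = "exp (- (s * t / (s + t) * (norm x)\<^sup>2))"
  have square: "exp (- (s * (norm (x - (?m + y)))\<^sup>2)) * exp (- (t * (norm (?m + y))\<^sup>2)) =
      ?E * exp (- ((s + t) * (norm y)\<^sup>2))" for y
  proof -
    have st: "s + t \<noteq> 0" using s t by simp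
    \<comment> \<open>In terms of \<open>u\<close> the identity is polynomial, and \<open>s (1 - u) = u t\<close> removes the mixed term.\<close>
    define u where "u = s / (s + t)"
    have us: "u * (s + t) = s" using st by (simp add: u_def)
    have ut: "s * t / (s + t) = u * t" by (simp add: u_def)
    have st2: "s * (1 - u) = u * t" using us by (simp add: algebra_simps)
    have x: "x - (u *\<^sub>R x + y) = (1 - u) *\<^sub>R x - y" by (simp add: algebra_simps)
    have a1: "(norm (x - (u *\<^sub>R x + y)))\<^sup>2 = (1-u)\<^sup>2 * (x \<bullet> x) - 2 * (1-u) * (x \<bullet> y) + y \<bullet> y"
      unfolding x power2_norm_eq_inner by (simp add: algebra_simps inner_commute power2_eq_square)
    have a2: "(norm (u *\<^sub>R x + y))\<^sup>2 = u\<^sup>2 * (x \<bullet> x) + 2 * u * (x \<bullet> y) + y \<bullet> y"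
      unfolding power2_norm_eq_inner by (simp add: algebra_simps inner_commute power2_eq_square)
    have "s * (norm (x - (u *\<^sub>R x + y)))\<^sup>2 + t * (norm (u *\<^sub>R x + y))\<^sup>2 =
        ((s * (1-u)) * (1 - u) + u * (u * t)) * (x \<bullet> x)
          + 2 * (u * t - s * (1-u)) * (x \<bullet> y) + (s + t) * (y \<bullet> y)"
      unfolding a1 a2 by (simp add: algebra_simps power2_eq_square)
    also have "\<dots> = u * t * (x \<bullet> x) + (s + t) * (y \<bullet> y)"
      unfolding st2 by (simp add: algebra_simps)
    finally show ?thesis
      unfolding exp_add [symmetric] u_def [symmetric] ut
      by (simp add: power2_norm_eq_inner)
  qed
  let ?f = "\<lambda>y. ennreal (exp (- (s * (norm (x - y))\<^sup>2)) * exp (- (t * (norm y)\<^sup>2)))"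
  have "(\<integral>\<^sup>+y. ?f y \<partial>lborel) = (\<integral>\<^sup>+y. ?f y \<partial>distr lborel borel ((+) ?m))"
    by (simp add: lborel_distr_plus)
  also have "\<dots> = (\<integral>\<^sup>+y. ?f (?m + y) \<partial>lborel)"
    by (subst nn_integral_distr) auto
  also have "\<dots> = ennreal ?E * (\<integral>\<^sup>+y. ennreal (exp (- ((s + t) * (norm (y::'a))\<^sup>2))) \<partial>lborel)"
    unfolding square by (subst nn_integral_cmult [symmetric]) (auto simp: ennreal_mult')
  also have "\<dots> = ennreal ((pi / (s + t)) powr (DIM('a) / 2) * ?E)"
    using s t by (subst nn_integral_gaussian) (auto simp: ennreal_mult' [symmetric] mult.commute)
  finally show ?thesis .
qed

text \<open>
  Euler's argument: \<open>\<Gamma>(u+v) (1+t) powr (-(u+v))\<close> is the Gamma integral with parameter \<open>1 + t\<close>; after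
  exchanging the integrals, the one over \<open>t\<close> is a Gamma integral with parameter \<open>s\<close>, and what is
  left is the integral for \<open>\<Gamma>(v)\<close>.
\<close>

lemma nn_integral_Beta_half_line:
  assumes u: "0 < u" and v: "0 < v"
  shows "(\<integral>\<^sup>+t. ennreal (half_line_power u t * (1 + t) powr - (u + v)) \<partial>lborel) =
         ennreal (Gamma u * Gamma v / Gamma (u + v))" (is "?I = _")
proof -
  have G: "0 < Gamma (u + v)" using u v by (intro Gamma_real_pos) simp
  have "ennreal (Gamma (u + v)) * ?I =
      (\<integral>\<^sup>+t. (\<integral>\<^sup>+s. ennreal (half_line_power u t * (half_line_power (u + v) s * exp (- ((1 + t) * s)))) \<partial>lborel) \<partial>lborel)"
  proof (subst nn_integral_cmult [symmetric], measurable, rule nn_integral_cong)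
    fix t :: real
    show "ennreal (Gamma (u + v)) * ennreal (half_line_power u t * (1 + t) powr - (u + v)) =
      (\<integral>\<^sup>+s. ennreal (half_line_power u t * (half_line_power (u + v) s * exp (- ((1 + t) * s)))) \<partial>lborel)"
    proof (cases "0 < t")
      case True
      have "(\<integral>\<^sup>+s. ennreal (half_line_power u t * (half_line_power (u + v) s * exp (- ((1 + t) * s)))) \<partial>lborel)
          = ennreal (half_line_power u t) * ennreal (Gamma (u + v) * (1 + t) powr - (u + v))"
        using True u v by (subst nn_integral_Gamma_scaled [symmetric])
          (auto simp: ennreal_mult' nn_integral_cmult)
      also have "\<dots> = ennreal (Gamma (u + v)) * ennreal (half_line_power u t * (1 + t) powr - (u + v))"
        using G by (simp add: ennreal_mult' [symmetric] mult_ac)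
      finally show ?thesis by simp
    qed (simp add: half_line_power_def)
  qed
  also have "\<dots> = (\<integral>\<^sup>+s. (\<integral>\<^sup>+t. ennreal (half_line_power u t * (half_line_power (u + v) s * exp (- ((1 + t) * s)))) \<partial>lborel) \<partial>lborel)"
    by (rule lborel_pair.Fubini') measurable
  also have "\<dots> = (\<integral>\<^sup>+s. ennreal (Gamma u) * ennreal (half_line_power v s * exp (- (1 * s))) \<partial>lborel)"
  proof (rule nn_integral_cong)
    fix s :: real
    show "(\<integral>\<^sup>+t. ennreal (half_line_power u t * (half_line_power (u + v) s * exp (- ((1 + t) * s)))) \<partial>lborel)
      = ennreal (Gamma u) * ennreal (half_line_power v s * exp (- (1 * s)))"
    proof (cases "0 < s")
      case True
      have split: "exp (- ((1 + t) * s)) = exp (- s) * exp (- (s * t))" for t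
        by (simp add: algebra_simps flip: exp_add)
      have "(\<integral>\<^sup>+t. ennreal (half_line_power u t * (half_line_power (u + v) s * exp (- ((1 + t) * s)))) \<partial>lborel)
          = (\<integral>\<^sup>+t. ennreal (half_line_power (u + v) s * exp (- s)) * ennreal (half_line_power u t * exp (- (s * t))) \<partial>lborel)"
        unfolding split by (intro nn_integral_cong) (simp add: ennreal_mult' [symmetric] mult_ac)
      also have "\<dots> = ennreal (half_line_power (u + v) s * exp (- s)) * ennreal (Gamma u * s powr - u)"
        using True u by (subst nn_integral_cmult) (auto simp: nn_integral_Gamma_scaled)
      also have "\<dots> = ennreal (Gamma u) * ennreal (half_line_power v s * exp (- (1 * s)))"
        using True Gamma_real_pos [OF u]
        by (simp add: ennreal_mult' [symmetric] half_line_power_def powr_add [symmetric] algebra_simps)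
      finally show ?thesis .
    qed (simp add: half_line_power_def)
  qed
  also have "\<dots> = ennreal (Gamma u) * ennreal (Gamma v * 1 powr - v)"
    using nn_integral_Gamma_scaled [OF v zero_less_one] by (subst nn_integral_cmult) auto
  finally have "ennreal (Gamma (u + v)) * ?I = ennreal (Gamma (u + v)) * ennreal (Gamma u * Gamma v / Gamma (u + v))"
    using G Gamma_real_pos [OF u] by (simp add: ennreal_mult' [symmetric])
  then show ?thesis
    using G by (simp add: ennreal_mult_cancel_left)
qed

section \<open>Convolution of two powers of the norm\<close>

text \<open>
  The right-hand exponent is forced by homogeneity; only the constant needs work. After both powers
  are replaced by superpositions of Gaussians with parameters \<open>s\<close> and \<open>t\<close>, the integral over \<open>y\<close> is
  \<open>nn_integral_gaussian_product\<close>. The substitution \<open>t = s r\<close> turns \<open>st/(s+t)\<close> into \<open>s\<close> times a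
  function of \<open>r\<close> alone, so that the parameters separate. The assumptions \<open>a, b < N\<close> and \<open>N < a + b\<close>
  express integrability at \<open>y = x\<close>, at \<open>y = 0\<close> and at infinity, and they reappear as positivity of the
  arguments of the three Gamma functions in the numerator.
\<close>

lemma nn_integral_Riesz_composition:
  fixes x :: "'a::euclidean_space" and a b :: real
  defines "N \<equiv> DIM('a) / 2"
  assumes a: "0 < a" "a < N" and b: "0 < b" "b < N" and ab: "N < a + b" and x: "x \<noteq> 0"
  shows "(\<integral>\<^sup>+y. ennreal (norm (x - y) powr (- 2 * a) * norm y powr (- 2 * b)) \<partial>lborel) =
         ennreal (pi powr N * (Gamma (N - a) * Gamma (N - b) * Gamma (a + b - N) /
                    (Gamma a * Gamma b * Gamma (2 * N - a - b))) *
                  norm x powr (2 * (N - a - b)))" (is "?L = ennreal ?R")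
proof -
  \<comment> \<open>The order of the Gamma integral in \<open>s\<close>: the densities and the Jacobian of \<open>t = s r\<close> contribute
    \<open>a + b\<close>, the normalisation of the Gaussian takes away \<open>N\<close>.\<close>
  define z where "z = a + b - N"
  have z: "0 < z" using ab by (simp add: z_def)
  let ?P = half_line_power
  let ?E = "\<lambda>s t y. exp (- (s * (norm (x - y))\<^sup>2)) * exp (- (t * (norm y)\<^sup>2))"
  let ?G = "\<lambda>s t. (pi / (s + t)) powr N * exp (- (s * t / (s + t) * (norm x)\<^sup>2))"
  let ?q = "\<lambda>r. r / (1 + r) * (norm x)\<^sup>2"
  have Ga: "0 < Gamma a" and Gb: "0 < Gamma b" and Gz: "0 < Gamma z"
    and Guv: "0 < Gamma (2 * N - a - b)"
    using a b z by (auto intro!: Gamma_real_pos)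
  have powr_sq: "(norm w)\<^sup>2 powr - c = norm w powr (- 2 * c)" if "w \<noteq> 0" for w :: 'a and c
    using that by (simp add: powr_powr flip: powr_numeral)
  have "ennreal (Gamma a * Gamma b) * ?L =
      (\<integral>\<^sup>+y. ennreal (Gamma a * Gamma b) * ennreal (norm (x - y) powr (- 2 * a) * norm y powr (- 2 * b)) \<partial>lborel)"
    by (rule nn_integral_cmult [symmetric]) measurable
  also have "\<dots> = (\<integral>\<^sup>+y. (\<integral>\<^sup>+s. (\<integral>\<^sup>+t. ennreal (?P a s * ?P b t * ?E s t y) \<partial>lborel) \<partial>lborel) \<partial>lborel)"
  proof (rule nn_integral_cong_AE)
    have "AE y in lborel. y \<noteq> x" "AE y in lborel. y \<noteq> (0::'a)"
      by (rule AE_lborel_singleton)+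
    then show "AE y in lborel. ennreal (Gamma a * Gamma b) *
          ennreal (norm (x - y) powr (- 2 * a) * norm y powr (- 2 * b)) =
        (\<integral>\<^sup>+s. (\<integral>\<^sup>+t. ennreal (?P a s * ?P b t * ?E s t y) \<partial>lborel) \<partial>lborel)"
    proof eventually_elim
      case (elim y)
      have "(\<integral>\<^sup>+s. (\<integral>\<^sup>+t. ennreal (?P a s * ?P b t * ?E s t y) \<partial>lborel) \<partial>lborel) =
         (\<integral>\<^sup>+s. (\<integral>\<^sup>+t. ennreal (?P a s * exp (- ((norm (x - y))\<^sup>2 * s))) * ennreal (?P b t * exp (- ((norm y)\<^sup>2 * t))) \<partial>lborel) \<partial>lborel)"
        by (simp add: ennreal_mult' [symmetric] mult_ac)
      also have "\<dots> = (\<integral>\<^sup>+s. ennreal (?P a s * exp (- ((norm (x - y))\<^sup>2 * s))) \<partial>lborel) *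
                      (\<integral>\<^sup>+t. ennreal (?P b t * exp (- ((norm y)\<^sup>2 * t))) \<partial>lborel)"
        by (simp add: nn_integral_cmult nn_integral_multc)
      also have "\<dots> = ennreal (Gamma a * norm (x - y) powr (- 2 * a)) * ennreal (Gamma b * norm y powr (- 2 * b))"
        using elim a b by (simp add: nn_integral_Gamma_scaled powr_sq)
      finally show ?case
        using Ga Gb by (simp add: ennreal_mult' [symmetric] mult_ac)
    qed
  qed
  also have "\<dots> = (\<integral>\<^sup>+s. (\<integral>\<^sup>+y. (\<integral>\<^sup>+t. ennreal (?P a s * ?P b t * ?E s t y) \<partial>lborel) \<partial>lborel) \<partial>lborel)"
    by (rule lborel_pair.Fubini') measurable
  also have "\<dots> = (\<integral>\<^sup>+s. (\<integral>\<^sup>+t. (\<integral>\<^sup>+y. ennreal (?P a s * ?P b t * ?E s t y) \<partial>lborel) \<partial>lborel) \<partial>lborel)"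
    by (intro nn_integral_cong lborel_pair.Fubini') measurable
  also have "\<dots> = (\<integral>\<^sup>+s. (\<integral>\<^sup>+r. ennreal (pi powr N * ?P b r * (1 + r) powr - N) *
                        ennreal (?P z s * exp (- (?q r * s))) \<partial>lborel) \<partial>lborel)"
  proof (rule nn_integral_cong)
    fix s :: real
    show "(\<integral>\<^sup>+t. (\<integral>\<^sup>+y. ennreal (?P a s * ?P b t * ?E s t y) \<partial>lborel) \<partial>lborel) =
      (\<integral>\<^sup>+r. ennreal (pi powr N * ?P b r * (1 + r) powr - N) * ennreal (?P z s * exp (- (?q r * s))) \<partial>lborel)"
    proof (cases "0 < s")
      case s: True
      have "(\<integral>\<^sup>+t. (\<integral>\<^sup>+y. ennreal (?P a s * ?P b t * ?E s t y) \<partial>lborel) \<partial>lborel) =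
            (\<integral>\<^sup>+t. ennreal (?P a s * ?P b t * ?G s t) \<partial>lborel)"
      proof (rule nn_integral_cong)
        fix t :: real
        show "(\<integral>\<^sup>+y. ennreal (?P a s * ?P b t * ?E s t y) \<partial>lborel) = ennreal (?P a s * ?P b t * ?G s t)"
        proof (cases "0 < t")
          case True
          have "(\<integral>\<^sup>+y. ennreal (?P a s * ?P b t * ?E s t y) \<partial>lborel) =
              ennreal (?P a s * ?P b t) * (\<integral>\<^sup>+y. ennreal (?E s t y) \<partial>lborel)"
            by (subst nn_integral_cmult [symmetric]) (auto simp: ennreal_mult')
          also have "\<dots> = ennreal (?P a s * ?P b t * ?G s t)"
            unfolding nn_integral_gaussian_product [OF s True] N_def by (simp add: ennreal_mult')
          finally show ?thesis .
        qed (simp add: half_line_power_def)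
      qed
      also have "\<dots> = ennreal s * (\<integral>\<^sup>+r. ennreal (?P a s * ?P b (s * r) * ?G s (s * r)) \<partial>lborel)"
        by (rule nn_integral_lborel_scale [OF _ s]) measurable
      also have "\<dots> = (\<integral>\<^sup>+r. ennreal s * ennreal (?P a s * ?P b (s * r) * ?G s (s * r)) \<partial>lborel)"
        by (rule nn_integral_cmult [symmetric]) measurable
      also have "\<dots> = (\<integral>\<^sup>+r. ennreal (pi powr N * ?P b r * (1 + r) powr - N) * ennreal (?P z s * exp (- (?q r * s))) \<partial>lborel)"
      proof (rule nn_integral_cong)
        fix r :: real
        have "s * (?P a s * ?P b (s * r) * ?G s (s * r)) =
              pi powr N * ?P b r * (1 + r) powr - N * (?P z s * exp (- (?q r * s)))"
        proof (cases "0 < r")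
          case r: True
          have e: "s * (s * r) / (s + s * r) * (norm x)\<^sup>2 = ?q r * s"
          proof -
            have "s + s * r = s * (1 + r)" by (simp add: algebra_simps)
            then show ?thesis using s r by simp
          qed
          have "pi / (s + s * r) = pi * (inverse s * inverse (1 + r))"
            using s r by (simp add: field_simps)
          then have f: "(pi / (s + s * r)) powr N = pi powr N * (s powr - N * (1 + r) powr - N)"
            using s r by (simp add: powr_mult powr_minus inverse_powr)
          have "s powr 1 * s powr (a - 1) * s powr (b - 1) * s powr - N = s powr (z - 1)"
            unfolding powr_add [symmetric] by (simp add: z_def algebra_simps)
          then have "s * ?P a s * s powr (b - 1) * s powr - N = ?P z s"
            using s by (simp add: half_line_power_def)
          then show ?thesis
            unfolding e f half_line_power_scale [OF s] by (simp add: mult_ac)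
        qed (use s in \<open>simp add: half_line_power_def zero_less_mult_iff\<close>)
        then show "ennreal s * ennreal (?P a s * ?P b (s * r) * ?G s (s * r)) =
          ennreal (pi powr N * ?P b r * (1 + r) powr - N) * ennreal (?P z s * exp (- (?q r * s)))"
          using s by (simp add: ennreal_mult' [symmetric])
      qed
      finally show ?thesis .
    qed (simp add: half_line_power_def)
  qed
  also have "\<dots> = (\<integral>\<^sup>+r. (\<integral>\<^sup>+s. ennreal (pi powr N * ?P b r * (1 + r) powr - N) *
                        ennreal (?P z s * exp (- (?q r * s))) \<partial>lborel) \<partial>lborel)"
    by (rule lborel_pair.Fubini') measurable
  also have "\<dots> = (\<integral>\<^sup>+r. ennreal (pi powr N * Gamma z * norm x powr (- 2 * z)) *
                     ennreal (?P (N - a) r * (1 + r) powr - ((N - a) + (N - b))) \<partial>lborel)"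
  proof (rule nn_integral_cong)
    fix r :: real
    show "(\<integral>\<^sup>+s. ennreal (pi powr N * ?P b r * (1 + r) powr - N) * ennreal (?P z s * exp (- (?q r * s))) \<partial>lborel) =
       ennreal (pi powr N * Gamma z * norm x powr (- 2 * z)) *
         ennreal (?P (N - a) r * (1 + r) powr - ((N - a) + (N - b)))"
    proof (cases "0 < r")
      case r: True
      have q: "0 < ?q r" using r x by simp
      have q_int: "(\<integral>\<^sup>+s. ennreal (pi powr N * ?P b r * (1 + r) powr - N) * ennreal (?P z s * exp (- (?q r * s))) \<partial>lborel) =
          ennreal (pi powr N * ?P b r * (1 + r) powr - N) * ennreal (Gamma z * ?q r powr - z)"
        by (subst nn_integral_cmult, measurable, subst nn_integral_Gamma_scaled [OF z q]) simp
      have q_powr: "?q r powr - z = r powr - z * (1 + r) powr z * norm x powr (- 2 * z)"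
        unfolding powr_mult powr_sq [OF x]
        using r by (simp add: powr_mult powr_divide powr_minus divide_inverse inverse_powr)
      have r1: "?P (N - a) r = ?P b r * r powr - z"
        using r by (simp add: half_line_power_def powr_add [symmetric] z_def algebra_simps)
      have r2: "(1 + r) powr - ((N - a) + (N - b)) = (1 + r) powr - N * (1 + r) powr z"
        by (simp add: powr_add [symmetric] z_def algebra_simps)
      show ?thesis
        unfolding q_int q_powr r1 r2
        using Gz by (simp add: ennreal_mult' [symmetric] mult_ac)
    qed (simp add: half_line_power_def)
  qed
  also have "\<dots> = ennreal (pi powr N * Gamma z * norm x powr (- 2 * z)) *
                 ennreal (Gamma (N - a) * Gamma (N - b) / Gamma ((N - a) + (N - b)))"
    using a b by (subst nn_integral_cmult, measurable, subst nn_integral_Beta_half_line) auto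
  also have "\<dots> = ennreal (Gamma a * Gamma b) * ennreal ?R"
  proof -
    have "pi powr N * Gamma z * norm x powr (- 2 * z) *
          (Gamma (N - a) * Gamma (N - b) / Gamma ((N - a) + (N - b))) = Gamma a * Gamma b * ?R"
      using Ga Gb Guv by (simp add: z_def field_simps)
    then show ?thesis
      using Ga Gb Gz by (simp add: ennreal_mult' [symmetric])
  qed
  finally show ?thesis
    using Ga Gb by (simp add: ennreal_mult_cancel_left)
qed

section \<open>The Schur test\<close>

text \<open>
  After normalising both factors, integrate Young's inequality. The exact value of the first integral
  and a mere bound for the second are what the Schur test supplies.
\<close>

lemma nn_integral_Holder:
  fixes u v :: "'a \<Rightarrow> real"
  assumes [measurable]: "u \<in> borel_measurable M" "v \<in> borel_measurable M"
    and u: "\<And>x. 0 \<le> u x" and v: "\<And>x. 0 \<le> v x"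
    and p: "1 < p" and pq: "1 / p + 1 / q = 1"
    and U: "(\<integral>\<^sup>+x. ennreal (u x powr p) \<partial>M) = ennreal U" "0 \<le> U"
    and V: "(\<integral>\<^sup>+x. ennreal (v x powr q) \<partial>M) \<le> ennreal V" "0 \<le> V"
  shows "(\<integral>\<^sup>+x. ennreal (u x * v x) \<partial>M) \<le> ennreal (U powr (1 / p) * V powr (1 / q))"
proof -
  have q: "1 < q"
  proof -
    have "0 < 1 / p" "1 / p < 1" using p by auto
    then have "0 < 1 / q" "1 / q < 1" using pq by linarith+
    then show ?thesis by (simp add: divide_less_eq split: if_splits)
  qed
  show ?thesis
  proof (cases "U = 0 \<or> V = 0")
    case True
    have "AE x in M. u x * v x = 0"
      using True
    proof
      assume "U = 0"
      then have "AE x in M. u x powr p = 0" using U by (simp add: nn_integral_0_iff_AE)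
      then show ?thesis by eventually_elim simp
    next
      assume "V = 0"
      then have "AE x in M. v x powr q = 0" using V by (simp add: nn_integral_0_iff_AE)
      then show ?thesis by eventually_elim simp
    qed
    then have "(\<integral>\<^sup>+x. ennreal (u x * v x) \<partial>M) = 0"
      by (simp add: nn_integral_0_iff_AE u v)
    then show ?thesis by simp
  next
    case False
    then have U0: "0 < U" and V0: "0 < V" using U V by auto
    define c where "c = U powr (1 / p)"
    define d where "d = V powr (1 / q)"
    have c: "0 < c" "c powr p = U" and d: "0 < d" "d powr q = V"
      using U0 V0 p q by (auto simp: c_def d_def powr_powr)
    have "(\<integral>\<^sup>+x. ennreal (u x * v x) \<partial>M) \<le>
        (\<integral>\<^sup>+x. ennreal (c * d / (p * U)) * ennreal (u x powr p) + ennreal (c * d / (q * V)) * ennreal (v x powr q) \<partial>M)"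
    proof (rule nn_integral_mono)
      fix x
      have "(u x / c) * (v x / d) \<le> (u x / c) powr p / p + (v x / d) powr q / q"
        using c d by (intro Youngs_inequality [OF p q pq]) (auto simp: u v)
      also have "\<dots> = u x powr p / (p * U) + v x powr q / (q * V)"
        using u [of x] v [of x] c d by (simp add: powr_divide mult.commute)
      finally have "(c * d) * ((u x / c) * (v x / d)) \<le> (c * d) * (u x powr p / (p * U) + v x powr q / (q * V))"
        using c d by (intro mult_left_mono) auto
      then have "u x * v x \<le> c * d / (p * U) * u x powr p + c * d / (q * V) * v x powr q"
        using c d by (simp add: algebra_simps)
      then show "ennreal (u x * v x) \<le>
          ennreal (c * d / (p * U)) * ennreal (u x powr p) + ennreal (c * d / (q * V)) * ennreal (v x powr q)"
        using c d p q U0 V0 by (simp add: ennreal_mult' [symmetric] ennreal_plus [symmetric] ennreal_leI del: ennreal_plus)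
    qed
    also have "\<dots> = ennreal (c * d / (p * U)) * ennreal U + ennreal (c * d / (q * V)) * (\<integral>\<^sup>+x. ennreal (v x powr q) \<partial>M)"
      by (simp add: nn_integral_add nn_integral_cmult U)
    also have "\<dots> \<le> ennreal (c * d / (p * U)) * ennreal U + ennreal (c * d / (q * V)) * ennreal V"
      by (intro add_left_mono mult_left_mono V) simp
    also have "\<dots> = ennreal (c * d * (1 / p + 1 / q))"
      using c d p q U0 V0
      by (simp add: ennreal_mult' [symmetric] ennreal_plus [symmetric] distrib_left del: ennreal_plus)
    finally show ?thesis by (simp add: pq c_def d_def)
  qed
qed

text \<open>
  Split \<open>K g = (K\<^bsup>1/p\<^esup> g/h) (K\<^bsup>1/q\<^esup> h)\<close> and apply Hoelder's inequality in \<open>y\<close>: the second factor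
  is controlled by the row condition, and the \<open>p\<close>-th power of the first, integrated against
  \<open>h powr p\<close> in \<open>x\<close>, by the column condition. The first step costs \<open>D powr (p/q)\<close>, the second
  \<open>D\<close>, in total \<open>D powr p\<close>. Finiteness of the row integrals almost everywhere is a separate
  conclusion because \<open>enn2real\<close> maps \<open>\<infinity>\<close> to \<open>0\<close>, so that the second conclusion alone would not imply
  it.
\<close>

lemma Schur_test:
  fixes K :: "'a \<Rightarrow> 'a \<Rightarrow> real" and h g :: "'a \<Rightarrow> real"
  assumes "sigma_finite_measure M"
    and K [measurable]: "(\<lambda>(x, y). K x y) \<in> borel_measurable (M \<Otimes>\<^sub>M M)"
    and h [measurable]: "h \<in> borel_measurable M" and g [measurable]: "g \<in> borel_measurable M"
    and K0: "\<And>x y. 0 \<le> K x y" and g0: "\<And>y. 0 \<le> g y" and h0: "\<And>y. 0 \<le> h y"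
    and hpos: "AE x in M. 0 < h x"
    and p: "1 < p" and pq: "1 / p + 1 / q = 1" and D: "0 \<le> D"
    and row: "AE x in M. (\<integral>\<^sup>+y. ennreal (K x y * h y powr q) \<partial>M) \<le> ennreal (D * h x powr q)"
    and col: "AE y in M. (\<integral>\<^sup>+x. ennreal (K x y * h x powr p) \<partial>M) \<le> ennreal (D * h y powr p)"
    and gp: "(\<integral>\<^sup>+y. ennreal (g y powr p) \<partial>M) < \<infinity>"
  shows "AE x in M. (\<integral>\<^sup>+y. ennreal (K x y * g y) \<partial>M) < \<infinity>"
    and "(\<integral>\<^sup>+x. ennreal (enn2real (\<integral>\<^sup>+y. ennreal (K x y * g y) \<partial>M) powr p) \<partial>M)
           \<le> ennreal (D powr p) * (\<integral>\<^sup>+y. ennreal (g y powr p) \<partial>M)"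
proof -
  interpret sigma_finite_measure M by fact
  interpret P: pair_sigma_finite M M ..
  have q: "0 < q"
  proof -
    have "1 / p < 1" using p by auto
    then have "0 < 1 / q" using pq by linarith
    then show ?thesis by simp
  qed
  have qp: "p / q + 1 = p"
  proof -
    have "p * (1 / p + 1 / q) = p" using pq by simp
    then show ?thesis using p by (simp add: distrib_left)
  qed
  define w where "w y = g y powr p * h y powr - p" for y
  have [measurable]: "w \<in> borel_measurable M" unfolding w_def [abs_def] by measurable
  have w0: "0 \<le> w y" for y by (simp add: w_def)
  define B where "B x = (\<integral>\<^sup>+y. ennreal (K x y * w y) \<partial>M)" for x
  have [measurable]: "B \<in> borel_measurable M" unfolding B_def [abs_def] by measurable
  have total: "(\<integral>\<^sup>+x. ennreal (h x powr p) * B x \<partial>M) \<le> ennreal D * (\<integral>\<^sup>+y. ennreal (g y powr p) \<partial>M)"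
  proof -
    have "(\<integral>\<^sup>+x. ennreal (h x powr p) * B x \<partial>M) = (\<integral>\<^sup>+x. (\<integral>\<^sup>+y. ennreal (w y * (K x y * h x powr p)) \<partial>M) \<partial>M)"
      unfolding B_def
      by (intro nn_integral_cong, subst nn_integral_cmult [symmetric])
         (auto simp: ennreal_mult' [symmetric] mult_ac)
    also have "\<dots> = (\<integral>\<^sup>+y. (\<integral>\<^sup>+x. ennreal (w y * (K x y * h x powr p)) \<partial>M) \<partial>M)"
      by (rule P.Fubini' [symmetric]) measurable
    also have "\<dots> = (\<integral>\<^sup>+y. ennreal (w y) * (\<integral>\<^sup>+x. ennreal (K x y * h x powr p) \<partial>M) \<partial>M)"
      by (intro nn_integral_cong, subst nn_integral_cmult [symmetric]) (auto simp: ennreal_mult' w0)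
    also have "\<dots> \<le> (\<integral>\<^sup>+y. ennreal D * ennreal (g y powr p) \<partial>M)"
    proof (rule nn_integral_mono_AE, use col hpos in eventually_elim)
      case (elim y)
      have "ennreal (w y) * (\<integral>\<^sup>+x. ennreal (K x y * h x powr p) \<partial>M) \<le> ennreal (w y) * ennreal (D * h y powr p)"
        by (intro mult_left_mono elim) simp
      also have "\<dots> = ennreal (D * (g y powr p * (h y powr - p * h y powr p)))"
        using D by (simp add: ennreal_mult' [symmetric] ennreal_mult'' [symmetric] w_def mult_ac)
      also have "\<dots> = ennreal D * ennreal (g y powr p)"
        using elim D by (simp add: powr_add [symmetric] ennreal_mult')
      finally show ?case .
    qed
    also have "\<dots> = ennreal D * (\<integral>\<^sup>+y. ennreal (g y powr p) \<partial>M)"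
      by (simp add: nn_integral_cmult)
    finally show ?thesis .
  qed
  also have "\<dots> < \<infinity>" using gp by (simp add: ennreal_mult_less_top)
  finally have "AE x in M. ennreal (h x powr p) * B x \<noteq> \<infinity>"
    by (intro nn_integral_noteq_infinite) auto
  then have Bfin: "AE x in M. B x < \<infinity>"
    using hpos by eventually_elim (auto simp: ennreal_mult_eq_top_iff less_top)
  have pointwise: "AE x in M. (\<integral>\<^sup>+y. ennreal (K x y * g y) \<partial>M)
      \<le> ennreal (enn2real (B x) powr (1 / p) * (D * h x powr q) powr (1 / q))"
    using Bfin row AE_space
  proof eventually_elim
    case (elim x)
    note elim(3) [measurable]
    let ?u = "\<lambda>y. K x y powr (1 / p) * (g y / h y)" and ?v = "\<lambda>y. K x y powr (1 / q) * h y"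
    have "(\<integral>\<^sup>+y. ennreal (K x y * g y) \<partial>M) = (\<integral>\<^sup>+y. ennreal (?u y * ?v y) \<partial>M)"
    proof (rule nn_integral_cong_AE, use hpos in eventually_elim)
      case (elim y)
      have "K x y powr (1 / p) * K x y powr (1 / q) = K x y"
        using K0 [of x y] by (simp add: powr_add [symmetric] pq)
      then show ?case using elim by (simp add: field_simps)
    qed
    also have "\<dots> \<le> ennreal (enn2real (B x) powr (1 / p) * (D * h x powr q) powr (1 / q))"
    proof (rule nn_integral_Holder [OF _ _ _ _ p pq])
      have "?u y powr p = K x y * w y" for y
        using K0 [of x y] g0 [of y] h0 [of y] p
        by (simp add: w_def powr_mult powr_powr powr_divide powr_minus divide_inverse inverse_powr)
      then show "(\<integral>\<^sup>+y. ennreal (?u y powr p) \<partial>M) = ennreal (enn2real (B x))"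
        using elim(1) by (simp add: B_def)
      have "?v y powr q = K x y * h y powr q" for y
        using K0 [of x y] h0 [of y] q by (simp add: powr_mult powr_powr)
      then show "(\<integral>\<^sup>+y. ennreal (?v y powr q) \<partial>M) \<le> ennreal (D * h x powr q)"
        using elim(2) by simp
    qed (use K0 g0 h0 D in auto)
    finally show ?case .
  qed
  then show "AE x in M. (\<integral>\<^sup>+y. ennreal (K x y * g y) \<partial>M) < \<infinity>"
    by eventually_elim (auto intro: le_less_trans)
  have "(\<integral>\<^sup>+x. ennreal (enn2real (\<integral>\<^sup>+y. ennreal (K x y * g y) \<partial>M) powr p) \<partial>M) \<le>
        (\<integral>\<^sup>+x. ennreal (D powr (p / q)) * (ennreal (h x powr p) * B x) \<partial>M)"
  proof (rule nn_integral_mono_AE, use pointwise Bfin in eventually_elim)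
    case (elim x)
    note le = elim(1)
    have "enn2real (\<integral>\<^sup>+y. ennreal (K x y * g y) \<partial>M) \<le> enn2real (B x) powr (1 / p) * (D * h x powr q) powr (1 / q)"
      using enn2real_mono [OF le] by simp
    then have "enn2real (\<integral>\<^sup>+y. ennreal (K x y * g y) \<partial>M) powr p \<le>
        (enn2real (B x) powr (1 / p) * (D * h x powr q) powr (1 / q)) powr p"
      using p by (intro powr_mono2) auto
    also have "\<dots> = enn2real (B x) * (D powr (p / q) * h x powr p)"
      using D h0 [of x] p q by (simp add: powr_mult powr_powr)
    finally have "ennreal (enn2real (\<integral>\<^sup>+y. ennreal (K x y * g y) \<partial>M) powr p) \<le>
        ennreal (D powr (p / q)) * (ennreal (h x powr p) * ennreal (enn2real (B x)))"
      by (simp add: ennreal_mult' [symmetric] ennreal_leI mult_ac)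
    then show ?case using elim(2) by simp
  qed
  also have "\<dots> = ennreal (D powr (p / q)) * (\<integral>\<^sup>+x. ennreal (h x powr p) * B x \<partial>M)"
    by (rule nn_integral_cmult) measurable
  also have "\<dots> \<le> ennreal (D powr (p / q)) * (ennreal D * (\<integral>\<^sup>+y. ennreal (g y powr p) \<partial>M))"
    by (intro mult_left_mono total) simp
  also have "\<dots> = ennreal (D powr (p / q) * D powr 1) * (\<integral>\<^sup>+y. ennreal (g y powr p) \<partial>M)"
    using D by (simp add: mult.assoc [symmetric] ennreal_mult')
  also have "D powr (p / q) * D powr 1 = D powr p"
    unfolding powr_add [symmetric] qp ..
  finally show "(\<integral>\<^sup>+x. ennreal (enn2real (\<integral>\<^sup>+y. ennreal (K x y * g y) \<partial>M) powr p) \<partial>M)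
           \<le> ennreal (D powr p) * (\<integral>\<^sup>+y. ennreal (g y powr p) \<partial>M)" .
qed

section \<open>The Stein-Weiss inequality\<close>

text \<open>
  Tonelli's theorem on \<open>lborel \<Otimes>\<^sub>M lborel\<close> needs an integrand that is measurable for the product
  \<open>\<sigma>\<close>-algebra. A Borel function of \<open>y\<close> times a Borel kernel is, while a Lebesgue measurable one may
  fail to be.
\<close>

lemma lebesgue_complex_borel_representative:
  fixes f :: "'a::euclidean_space \<Rightarrow> complex"
  assumes f: "f \<in> borel_measurable lebesgue"
  obtains g where "g \<in> borel_measurable borel" "AE x in lborel. f x = g x"
proof -
  have "(\<lambda>x. Re (f x)) \<in> borel_measurable lebesgue" "(\<lambda>x. Im (f x)) \<in> borel_measurable lebesgue"
    using f by measurable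
  then obtain u v where uv: "u \<in> borel_measurable lborel" "AE x in lborel. Re (f x) = u x"
      "v \<in> borel_measurable lborel" "AE x in lborel. Im (f x) = v x"
    by (metis completion_ex_borel_measurable_real)
  show thesis
  proof (rule that)
    show "(\<lambda>x. Complex (u x) (v x)) \<in> borel_measurable borel"
      using uv(1,3) unfolding Complex_eq by (intro borel_measurable_add borel_measurable_times) auto
    show "AE x in lborel. f x = Complex (u x) (v x)"
      using uv(2,4) by eventually_elim (simp add: complex_eq_iff)
  qed
qed

definition stein_weiss_kernel :: "real \<Rightarrow> real \<Rightarrow> real \<Rightarrow> 'a::euclidean_space \<Rightarrow> 'a \<Rightarrow> real" where
  "stein_weiss_kernel \<alpha> lam \<beta> x y = norm x powr - \<alpha> * norm (x - y) powr - lam * norm y powr - \<beta>"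

lemma stein_weiss_kernel_measurable [measurable]:
  "(\<lambda>(x, y). stein_weiss_kernel \<alpha> lam \<beta> x (y::'a::euclidean_space)) \<in> borel_measurable (lborel \<Otimes>\<^sub>M lborel)"
  unfolding stein_weiss_kernel_def by measurable

text \<open>
  The eigenvalue equation behind the sharp constant: \<open>D\<close> is the eigenvalue of the kernel at the
  critical power \<open>|y|\<close> to the exponent \<open>-n/p\<close>. The conditions \<open>\<alpha> < n/p\<close> and \<open>\<beta> < n/p'\<close> are convergence
  at infinity and at the origin; \<open>lam < n\<close> is convergence at \<open>y = x\<close>.
\<close>

lemma stein_weiss_kernel_power:
  fixes x :: "'a::euclidean_space"
  assumes n: "n = DIM('a)" and pq: "1 / p + 1 / p' = 1"
    and lam: "0 < lam" "lam < real n"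
    and \<alpha>: "\<alpha> < real n / p" and \<beta>: "\<beta> < real n / p'" and bal: "real n = lam + \<alpha> + \<beta>"
    and x: "x \<noteq> 0"
  shows "(\<integral>\<^sup>+y. ennreal (stein_weiss_kernel \<alpha> lam \<beta> x y * norm y powr - (real n / p)) \<partial>lborel) =
         ennreal (stein_weiss_const n p p' \<alpha> \<beta> * norm x powr - (real n / p))"
proof -
  define P where "P = real n / p"
  define P' where "P' = real n / p'"
  have "real n * (1 / p + 1 / p') = real n" using pq by simp
  then have PP: "P + P' = real n" by (simp add: P_def P'_def distrib_left)
  have half: "real n / (2 * p) = P / 2" "real n / (2 * p') = P' / 2"
    by (simp_all add: P_def P'_def)
  define N where "N = real DIM('a) / 2"
  have N: "real n = 2 * N" by (simp add: N_def n)
  define a where "a = lam / 2"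
  define b where "b = (\<beta> + P) / 2"
  have ab: "0 < a" "a < N" "0 < b" "b < N" "N < a + b"
    using lam \<alpha> \<beta> bal PP N unfolding a_def b_def P_def [symmetric] P'_def [symmetric] add_divide_distrib diff_divide_distrib
    by - linarith+
  have const: "stein_weiss_const n p p' \<alpha> \<beta> =
      pi powr N * (Gamma (N - a) * Gamma (N - b) * Gamma (a + b - N) /
                    (Gamma a * Gamma b * Gamma (2 * N - a - b)))"
  proof -
    have "(\<alpha> + \<beta>) / 2 = N - a" "real n / (2 * p) - \<alpha> / 2 = a + b - N"
      "real n / (2 * p') - \<beta> / 2 = N - b" "(real n - \<alpha> - \<beta>) / 2 = a"
      "real n / (2 * p') + \<alpha> / 2 = 2 * N - a - b" "real n / (2 * p) + \<beta> / 2 = b" "real n / 2 = N"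
      using PP bal N unfolding a_def b_def half add_divide_distrib diff_divide_distrib
      by - linarith+
    then show ?thesis unfolding stein_weiss_const_def by (simp only: mult_ac)
  qed
  have "(\<integral>\<^sup>+y. ennreal (stein_weiss_kernel \<alpha> lam \<beta> x y * norm y powr - P) \<partial>lborel) =
      (\<integral>\<^sup>+y. ennreal (norm x powr - \<alpha>) * ennreal (norm (x - y) powr (- 2 * a) * norm y powr (- 2 * b)) \<partial>lborel)"
  proof -
    have "- 2 * a = - lam" "- 2 * b = - \<beta> + - P" by (simp_all add: a_def b_def)
    then show ?thesis
      by (simp only: stein_weiss_kernel_def powr_add ennreal_mult' [symmetric] powr_ge_zero mult.assoc)
  qed
  also have "\<dots> = ennreal (norm x powr - \<alpha>) *
      ennreal (stein_weiss_const n p p' \<alpha> \<beta> * norm x powr (2 * (N - a - b)))"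
    unfolding const
    using nn_integral_Riesz_composition [OF ab(1) ab(2) [unfolded N_def] ab(3) ab(4) [unfolded N_def] ab(5) [unfolded N_def] x]
    unfolding N_def [symmetric] by (subst nn_integral_cmult) auto
  also have "\<dots> = ennreal (stein_weiss_const n p p' \<alpha> \<beta> * (norm x powr - \<alpha> * norm x powr (2 * (N - a - b))))"
    by (simp add: ennreal_mult' [symmetric] mult_ac)
  also have "norm x powr - \<alpha> * norm x powr (2 * (N - a - b)) = norm x powr - P"
  proof -
    have "- \<alpha> + 2 * (N - a - b) = - P"
      using bal N by (simp add: a_def b_def algebra_simps add_divide_distrib)
    then show ?thesis unfolding powr_add [symmetric] by (rule arg_cong)
  qed
  finally show ?thesis by (simp add: P_def)
qed

text \<open>
  The constant is invariant under passing to the transposed kernel, which exchanges \<open>p\<close> with \<open>p'\<close> and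
  \<open>\<alpha>\<close> with \<open>\<beta>\<close>. Hence the row and the column condition of the Schur test hold with the same number.
\<close>

lemma stein_weiss_const_swap: "stein_weiss_const n p' p \<beta> \<alpha> = stein_weiss_const n p p' \<alpha> \<beta>"
  by (simp add: stein_weiss_const_def mult_ac add.commute diff_diff_eq)

lemma stein_weiss_const_nonneg:
  assumes pq: "1 / p + 1 / p' = 1"
    and lam: "0 < lam" "lam < real n"
    and \<alpha>: "\<alpha> < real n / p" and \<beta>: "\<beta> < real n / p'" and bal: "real n = lam + \<alpha> + \<beta>"
  shows "0 \<le> stein_weiss_const n p p' \<alpha> \<beta>"
proof -
  define P where "P = real n / p"
  define P' where "P' = real n / p'"
  have "real n * (1 / p + 1 / p') = real n" using pq by simp
  then have PP: "P + P' = real n" by (simp add: P_def P'_def distrib_left)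
  have half: "real n / (2 * p) = P / 2" "real n / (2 * p') = P' / 2" by (simp_all add: P_def P'_def)
  have "0 < (\<alpha> + \<beta>) / 2" "0 < real n / (2 * p) - \<alpha> / 2" "0 < real n / (2 * p') - \<beta> / 2"
    "0 < (real n - \<alpha> - \<beta>) / 2" "0 < real n / (2 * p') + \<alpha> / 2" "0 < real n / (2 * p) + \<beta> / 2"
    using PP lam \<alpha> \<beta> bal unfolding half P_def [symmetric] P'_def [symmetric] add_divide_distrib diff_divide_distrib
    by - linarith+
  then show ?thesis
    unfolding stein_weiss_const_def
    by (intro mult_nonneg_nonneg divide_nonneg_nonneg order.strict_implies_order [OF Gamma_real_pos]) auto
qed

text \<open>
  The Schur weight \<open>h\<close> is chosen so that \<open>h powr p'\<close> and \<open>h powr p\<close> are the critical powers of the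
  kernel and of its transpose, with exponents \<open>-n/p\<close> and \<open>-n/p'\<close>.
\<close>

lemma stein_weiss_nn_integral:
  fixes g :: "'a::euclidean_space \<Rightarrow> real"
  assumes n: "n = DIM('a)" and p: "1 < p" and pq: "1 / p + 1 / p' = 1"
    and lam: "0 < lam" "lam < real n"
    and \<alpha>: "\<alpha> < real n / p" and \<beta>: "\<beta> < real n / p'" and bal: "real n = lam + \<alpha> + \<beta>"
    and g: "g \<in> borel_measurable borel" "\<And>y. 0 \<le> g y"
    and gp: "(\<integral>\<^sup>+y. ennreal (g y powr p) \<partial>lborel) < \<infinity>"
  shows "AE x in lborel. (\<integral>\<^sup>+y. ennreal (stein_weiss_kernel \<alpha> lam \<beta> x y * g y) \<partial>lborel) < \<infinity>" (is ?A)
    and "(\<integral>\<^sup>+x. ennreal (enn2real (\<integral>\<^sup>+y. ennreal (stein_weiss_kernel \<alpha> lam \<beta> x y * g y) \<partial>lborel) powr p) \<partial>lborel)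
           \<le> ennreal (stein_weiss_const n p p' \<alpha> \<beta> powr p) * (\<integral>\<^sup>+y. ennreal (g y powr p) \<partial>lborel)" (is ?B)
proof -
  let ?K = "stein_weiss_kernel \<alpha> lam \<beta> :: 'a \<Rightarrow> 'a \<Rightarrow> real"
  let ?D = "stein_weiss_const n p p' \<alpha> \<beta>"
  define h :: "'a \<Rightarrow> real" where "h y = norm y powr - (real n / (p * p'))" for y
  have p': "p' \<noteq> 0" using p pq by (cases "p' = 0") auto
  have hq: "h y powr p' = norm y powr - (real n / p)" and hp: "h y powr p = norm y powr - (real n / p')" for y
    using p p' by (auto simp: h_def powr_powr)
  have [measurable]: "h \<in> borel_measurable borel" unfolding h_def [abs_def] by measurable
  have nz: "AE x in lborel. x \<noteq> (0::'a)" by (rule AE_lborel_singleton)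
  have D: "0 \<le> ?D" by (rule stein_weiss_const_nonneg [OF pq lam \<alpha> \<beta> bal])
  have row: "AE x in lborel. (\<integral>\<^sup>+y. ennreal (?K x y * h y powr p') \<partial>lborel) \<le> ennreal (?D * h x powr p')"
    using nz by eventually_elim (simp add: hq stein_weiss_kernel_power [OF n pq lam \<alpha> \<beta> bal])
  have pq': "1 / p' + 1 / p = 1" and bal': "real n = lam + \<beta> + \<alpha>" using pq bal by auto
  have swap: "?K x y = stein_weiss_kernel \<beta> lam \<alpha> y x" for x y
    by (simp add: stein_weiss_kernel_def norm_minus_commute mult_ac)
  have col: "AE y in lborel. (\<integral>\<^sup>+x. ennreal (?K x y * h x powr p) \<partial>lborel) \<le> ennreal (?D * h y powr p)"
    using nz
    by eventually_elim
       (simp add: hp swap stein_weiss_kernel_power [OF n pq' lam \<beta> \<alpha> bal'] stein_weiss_const_swap [of n p' p])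
  have hpos: "AE x in lborel. 0 < h x"
    using nz by eventually_elim (simp add: h_def)
  note S = Schur_test [OF lborel.sigma_finite_measure_axioms stein_weiss_kernel_measurable _ _ _ g(2) _ hpos p pq D row col gp]
  show ?A by (rule S(1)) (use g in \<open>auto simp: stein_weiss_kernel_def h_def\<close>)
  show ?B by (rule S(2)) (use g in \<open>auto simp: stein_weiss_kernel_def h_def\<close>)
qed

text \<open>
  The inequality for nonnegative functions is applied to \<open>|g|\<close>, where \<open>g\<close> is a Borel representative of
  \<open>f\<close>. Replacing \<open>f\<close> by \<open>g\<close> changes the convolution at no point \<open>x\<close>, since for every \<open>x\<close> the two
  integrands agree for almost all \<open>y\<close>. At almost every \<open>x\<close> the integral for \<open>|g|\<close> is finite and dominates
  the modulus of the complex convolution.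
\<close>

theorem stein_weiss_euclidean:
  fixes f :: "'a::euclidean_space \<Rightarrow> complex"
  assumes n: "n = DIM('a)" and p: "1 < p" and pq: "1 / p + 1 / p' = 1"
    and lam: "0 < lam" "lam < real n"
    and \<alpha>: "\<alpha> < real n / p" and \<beta>: "\<beta> < real n / p'" and bal: "real n = lam + \<alpha> + \<beta>"
    and f: "in_Lp p f"
  defines "Tf \<equiv> \<lambda>x. norm_power (- \<alpha>) x *\<^sub>R
            convolution (norm_power (- lam)) (\<lambda>y. norm_power (- \<beta>) y *\<^sub>R f y) x"
  shows "AE x in lebesgue. convolution_converges (norm_power (- lam)) (\<lambda>y. norm_power (- \<beta>) y *\<^sub>R f y) x"
    and "in_Lp p Tf"
    and "Lp_norm p Tf \<le> stein_weiss_const n p p' \<alpha> \<beta> * Lp_norm p f"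
proof -
  let ?D = "stein_weiss_const n p p' \<alpha> \<beta>"
  have D: "0 \<le> ?D" by (rule stein_weiss_const_nonneg [OF pq lam \<alpha> \<beta> bal])
  have [measurable]: "f \<in> borel_measurable lebesgue" and f_int: "integrable lebesgue (\<lambda>x. norm (f x) powr p)"
    using f by (auto simp: in_Lp_def)
  obtain g where g [measurable]: "g \<in> borel_measurable borel" and fg: "AE x in lborel. f x = g x"
    using lebesgue_complex_borel_representative [OF \<open>f \<in> borel_measurable lebesgue\<close>] .
  define S where "S = (LINT x|lebesgue. norm (f x) powr p)"
  have S0: "0 \<le> S" by (simp add: S_def)
  have gS: "(\<integral>\<^sup>+y. ennreal (norm (g y) powr p) \<partial>lborel) = ennreal S"
  proof -
    have "(\<integral>\<^sup>+y. ennreal (norm (g y) powr p) \<partial>lborel) = (\<integral>\<^sup>+y. ennreal (norm (f y) powr p) \<partial>lborel)"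
      by (rule nn_integral_cong_AE, use fg in eventually_elim) simp
    also have "\<dots> = (\<integral>\<^sup>+y. ennreal (norm (f y) powr p) \<partial>lebesgue)"
      by (simp add: nn_integral_completion)
    also have "\<dots> = ennreal S"
      unfolding S_def using f_int by (intro nn_integral_eq_integral) auto
    finally show ?thesis .
  qed
  define G where "G x y = norm_power (- lam) (x - y) *\<^sub>R norm_power (- \<beta>) y *\<^sub>R g y" for x y
  have G_meas [measurable]: "case_prod G \<in> borel_measurable (lborel \<Otimes>\<^sub>M lborel)"
    unfolding G_def norm_power_def by measurable
  have Gx [measurable]: "G x \<in> borel_measurable borel" for x
    unfolding G_def norm_power_def by measurable
  have w_meas: "(\<lambda>y. norm_power c (x - y)) \<in> borel_measurable lebesgue" "norm_power c \<in> borel_measurable lebesgue"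
    for c and x :: 'a
    unfolding norm_power_def [abs_def] by (auto intro!: measurable_completion)
  have F_meas: "(\<lambda>y. norm_power (- lam) (x - y) *\<^sub>R norm_power (- \<beta>) y *\<^sub>R f y) \<in> borel_measurable lebesgue" for x
    by (intro borel_measurable_scaleR w_meas) measurable
  have FG: "AE y in lebesgue. norm_power (- lam) (x - y) *\<^sub>R norm_power (- \<beta>) y *\<^sub>R f y = G x y" for x
    unfolding AE_completion_iff using fg by eventually_elim (simp add: G_def)
  have Gx': "G x \<in> borel_measurable lebesgue" for x
    by (rule measurable_completion) simp
  have converges: "convolution_converges (norm_power (- lam)) (\<lambda>y. norm_power (- \<beta>) y *\<^sub>R f y) x
      \<longleftrightarrow> integrable lborel (G x)" for x
    unfolding convolution_converges_def
    using integrable_cong_AE [OF F_meas Gx' FG] by (simp add: integrable_completion)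
  have conv: "convolution (norm_power (- lam)) (\<lambda>y. norm_power (- \<beta>) y *\<^sub>R f y) x = (LINT y|lborel. G x y)" for x
    unfolding convolution_def
    using integral_cong_AE [OF F_meas Gx' FG] by (simp add: integral_completion)
  have Tf: "Tf x = norm_power (- \<alpha>) x *\<^sub>R (LINT y|lborel. G x y)" for x
    by (simp add: Tf_def conv)
  have Tf_meas [measurable]: "Tf \<in> borel_measurable borel"
    unfolding Tf [abs_def] norm_power_def by measurable
  define I where "I x = (\<integral>\<^sup>+y. ennreal (stein_weiss_kernel \<alpha> lam \<beta> x y * norm (g y)) \<partial>lborel)" for x
  have I: "AE x in lborel. I x < \<infinity>"
    "(\<integral>\<^sup>+x. ennreal (enn2real (I x) powr p) \<partial>lborel) \<le> ennreal (?D powr p) * ennreal S"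
    using stein_weiss_nn_integral [OF n p pq lam \<alpha> \<beta> bal, of "\<lambda>y. norm (g y)"] gS
    by (auto simp: I_def)
  have pointwise: "integrable lborel (G x) \<and> norm (Tf x) \<le> enn2real (I x)" if x: "x \<noteq> 0" and Ix: "I x < \<infinity>" for x
  proof -
    have pos: "0 < norm_power (- \<alpha>) x" using x by (simp add: norm_power_def)
    have "I x = (\<integral>\<^sup>+y. ennreal (norm_power (- \<alpha>) x) * ennreal (norm (G x y)) \<partial>lborel)"
      unfolding I_def
      by (intro nn_integral_cong) (simp add: stein_weiss_kernel_def G_def norm_power_def ennreal_mult' [symmetric] mult_ac)
    also have "\<dots> = ennreal (norm_power (- \<alpha>) x) * (\<integral>\<^sup>+y. ennreal (norm (G x y)) \<partial>lborel)"
      by (rule nn_integral_cmult) simp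
    finally have I_eq: "I x = ennreal (norm_power (- \<alpha>) x) * (\<integral>\<^sup>+y. ennreal (norm (G x y)) \<partial>lborel)" .
    then have "(\<integral>\<^sup>+y. ennreal (norm (G x y)) \<partial>lborel) < \<infinity>"
      using Ix pos by (auto simp: ennreal_mult_less_top)
    then have int: "integrable lborel (G x)"
      by (intro integrableI_bounded) auto
    have "ennreal (norm (Tf x)) = ennreal (norm_power (- \<alpha>) x) * ennreal (norm (LINT y|lborel. G x y))"
      using pos by (simp add: Tf ennreal_mult')
    also have "\<dots> \<le> I x"
      unfolding I_eq by (intro mult_left_mono integral_norm_bound_ennreal int) simp
    finally have "norm (Tf x) \<le> enn2real (I x)"
      using enn2real_mono [of "ennreal (norm (Tf x))" "I x"] Ix by simp
    with int show ?thesis ..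
  qed
  have nz: "AE x in lborel. x \<noteq> (0::'a)" by (rule AE_lborel_singleton)
  show "AE x in lebesgue. convolution_converges (norm_power (- lam)) (\<lambda>y. norm_power (- \<beta>) y *\<^sub>R f y) x"
    unfolding converges AE_completion_iff using nz I(1) by eventually_elim (simp add: pointwise)
  have bound: "(\<integral>\<^sup>+x. ennreal (norm (Tf x) powr p) \<partial>lborel) \<le> ennreal (?D powr p * S)"
  proof -
    have "(\<integral>\<^sup>+x. ennreal (norm (Tf x) powr p) \<partial>lborel) \<le> (\<integral>\<^sup>+x. ennreal (enn2real (I x) powr p) \<partial>lborel)"
    proof (rule nn_integral_mono_AE, use nz I(1) in eventually_elim)
      case (elim x)
      then show ?case using pointwise [of x] p by (intro ennreal_leI powr_mono2) auto
    qed
    also note I(2)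
    finally show ?thesis using S0 by (simp add: ennreal_mult')
  qed
  have int: "integrable lborel (\<lambda>x. norm (Tf x) powr p)"
    using bound by (intro integrableI_bounded) (auto intro: le_less_trans)
  have Tf_leb: "(\<lambda>x. norm (Tf x) powr p) \<in> borel_measurable lborel" by measurable
  show "in_Lp p Tf"
    unfolding in_Lp_def integrable_completion [OF Tf_leb] using int by (auto intro: measurable_completion)
  have "(LINT x|lborel. norm (Tf x) powr p) \<le> ?D powr p * S"
    using bound S0 nn_integral_eq_integral [OF int] by (simp add: ennreal_le_iff)
  then have "(LINT x|lborel. norm (Tf x) powr p) powr (1 / p) \<le> (?D powr p * S) powr (1 / p)"
    using p by (intro powr_mono2) auto
  also have "\<dots> = ?D * S powr (1 / p)"
    using D S0 p by (simp add: powr_mult powr_powr)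
  finally show "Lp_norm p Tf \<le> ?D * Lp_norm p f"
    unfolding Lp_norm_def integral_completion [OF Tf_leb] S_def .
qed

theorem theorem2:
  fixes f :: "real ^ 'n \<Rightarrow> complex"
    and n :: nat
    and p p' lam \<alpha> \<beta> :: real
  assumes "n = CARD('n)"
    and "1 < p" and "1 / p + 1 / p' = 1"
    and "0 < lam" and "lam < real n"
    and "\<alpha> < real n / p" and "\<beta> < real n / p'"
    and "real n = lam + \<alpha> + \<beta>"
    and "in_Lp p f"
  shows "(AE x in lebesgue.
            convolution_converges (norm_power (- lam)) (\<lambda>y. norm_power (- \<beta>) y *\<^sub>R f y) x) \<and>
         in_Lp p (\<lambda>x. norm_power (- \<alpha>) x *\<^sub>R
            convolution (norm_power (- lam)) (\<lambda>y. norm_power (- \<beta>) y *\<^sub>R f y) x) \<and>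
         Lp_norm p (\<lambda>x. norm_power (- \<alpha>) x *\<^sub>R
            convolution (norm_power (- lam)) (\<lambda>y. norm_power (- \<beta>) y *\<^sub>R f y) x)
         \<le> stein_weiss_const n p p' \<alpha> \<beta> * Lp_norm p f"
proof -
  have "n = DIM(real ^ 'n)" using assms(1) by simp
  note * = stein_weiss_euclidean [OF this assms(2-)]
  show ?thesis by (intro conjI *)
qed

end
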